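(* (1) Let $(D,\prec_{\Omega}, \succ_{\Omega})$ be a matching dendriform algebra and $p: D \rightarrow D$ a matching dendriform algebra endomorphism. Then $(D, \prec_{p,\Omega}, \succ_{p,\Omega},p)$, where $\prec_{p,\omega}:=p\circ \prec_{\omega}$ and $\succ_{p,\omega}:=p \circ \succ_{\omega}$ for each $\omega \in \Omega$, is a matching Hom-dendriform algebra. Moreover, suppose that $(D', \prec'_{\Omega}, \succ'_{\Omega})$ is another matching dendriform algebra and $p':D' \rightarrow D'$ is a matching dendriform algebra endomorphism. If $f: D \rightarrow D'$ is a matching dendriform algebra morphism that satisfies $f \circ p =p' \circ f$, then $$f: (D,\prec_{p, \Omega},\succ_{p, \Omega},p)\rightarrow (D',\prec'_{p', \Omega},\succ'_{p', \Omega},p')$$ is a morphism of matching Hom-dendriform algebras, where $\prec'_{p',\omega}:=p'\circ\prec'_\omega$ and $\succ'_{p',\omega}:=p'\circ\succ'_\omega$. (2) Let $(D,\prec_{\Omega},\bullet_{\Omega}, \succ_{\Omega})$ be a matching tridendriform algebra and $p: D \rightarrow D$ a matching tridendriform algebra endomorphism. Then $(D,\prec_{p,\Omega},\bullet_{p,\Omega}, \succ_{p,\Omega},p)$, where $\prec_{p,\omega}:=p\circ \prec_{\omega}$, $\bullet_{p, \omega}:= p \circ \bullet_{\omega}$ and $\succ_{p,\omega}:=p \circ \succ_{\omega}$ for each $\omega \in \Omega$, is a matching Hom-tridendriform algebra. Moreover, suppose that $(D', \prec'_{\Omega},\bullet'_{\Omega}, \succ'_{\Omega})$ is another matching tridendriform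 algebra and $p':D' \rightarrow D'$ is a matching tridendriform algebra endomorphism. If $f: D \rightarrow D'$ is a matching tridendriform algebra morphism that satisfies $f \circ p =p' \circ f$, then $$f: (D,\prec_{p, \Omega},\bullet_{p,\Omega},\succ_{p, \Omega} ,p)\rightarrow (D',\prec'_{p', \Omega},\bullet'_{p',\Omega}, \succ'_{p', \Omega},p')$$ is a morphism of matching Hom-tridendriform algebras, where $\odot'_{p',\omega}:=p'\circ\odot'_\omega$ for $\odot\in\{\prec,\bullet,\succ\}$.
   Context: Let $\mathbf{k}$ be a unitary commutative ring, the base ring of all modules and linear maps, and let $\Omega$ be a nonempty set; a subscript $\Omega$ denotes a family indexed by $\Omega$, e.g. $\prec_\Omega=(\prec_\omega)_{\omega\in\Omega}$. A matching Hom-dendriform algebra $(D,\prec_\Omega,\succ_\Omega,p)$ is a $\mathbf{k}$-module $D$ with bilinear operations $\prec_\omega,\succ_\omega: D\otimes D\to D$ ($\omega\in\Omega$) and a linear map $p:D\to D$ such that for all $x,y,z\in D$, $\alpha,\beta\in\Omega$: $$(x \prec_{\alpha} y) \prec_{\beta} p(z)= p(x) \prec_{\alpha} (y \prec_{\beta} z)+ p(x) \prec_{\beta} (y \succ_{\alpha} z),$$ $$(x \succ_{\alpha} y) \prec_{\beta} p(z)= p(x) \succ_{\alpha} (y \prec_{\beta} z),$$ $$(x \prec_{\beta} y) \succ_{\alpha} p(z)+ (x \succ_{\alpha} y) \succ_{\beta} p(z) = p(x) \succ_{\alpha} (y \succ_{\beta} z).$$ A matching Hom-tridendriform algebra $(D,\prec_\Omega,\bullet_\Omega,\succ_\Omega,p)$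 is a $\mathbf{k}$-module $D$ with bilinear operations $\prec_\omega,\bullet_\omega,\succ_\omega$ ($\omega\in\Omega$) and a linear map $p:D\to D$ such that for all $x,y,z\in D$, $\alpha,\beta\in\Omega$: $$(x \prec_{\alpha} y) \prec_{\beta} p(z) = p(x) \prec_{\alpha} (y \prec_{\beta} z)+ p(x) \prec_{\beta} (y \succ_{\alpha} z)+ p(x) \prec_{\alpha} (y \bullet_{\beta} z),$$ $$(x \succ_{\alpha} y) \prec_{\beta} p(z) = p(x) \succ_{\alpha} (y \prec_{\beta} z),$$ $$p(x) \succ_{\alpha} (y \succ_{\beta} z) = (x \prec_{\beta} y) \succ_{\alpha} p(z) + (x \succ_{\alpha} y) \succ_{\beta} p(z)+(x \bullet_{\beta} y) \succ_{\alpha} p(z),$$ $$(x \succ_{\alpha} y) \bullet_{\beta} p(z)= p(x) \succ_{\alpha} (y \bullet_{\beta} z),\qquad (x \prec_{\alpha} y) \bullet_{\beta} p(z)= p(x) \bullet_{\beta}(y \succ_{\alpha} z),$$ $$(x \bullet_{\alpha} y) \prec_{\beta} p(z)= p(x) \bullet_{\alpha} (y \prec_{\beta} z),\qquad (x \bullet_{\alpha} y) \bullet_{\beta} p(z) = p(x) \bullet_{\alpha} (y \bullet_{\beta} z).$$ A matching dendriform (resp. tridendriform) algebra is the same structure with $p=\mathrm{id}$ (so $p$ is dropped from the notation). A matching Hom-dendriform (resp. Hom-tridendriform) algebra morphism from $D$ (with map $p$) to $D'$ (with map $p'$) is a linear map $f:D\to D'$ such that $f(x\odot_\omega y)=f(x)\odot'_\omega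 f(y)$ for all $x,y\in D$, $\omega\in\Omega$ and all operations $\odot\in\{\prec,\succ\}$ (resp. $\odot\in\{\prec,\bullet,\succ\}$), and $p'\circ f=f\circ p$. A morphism of matching (tri)dendriform algebras is a linear map satisfying only the compatibility with the operations; an endomorphism is a morphism from an algebra to itself. *)

theory Defs
  imports "HOL-Algebra.Module"
begin

text \<open>
  Modules are the carrier-based modules of HOL-Algebra over a commutative ring \<open>R\<close> with unit (which
  may be the zero ring). The families \<open>\<prec>\<^sub>\<Omega>\<close>, \<open>\<bullet>\<^sub>\<Omega>\<close>, \<open>\<succ>\<^sub>\<Omega>\<close> are functions \<open>prec\<close>, \<open>dot\<close>, \<open>succ\<close> whose
  first argument is the index, so \<open>prec \<omega> x y\<close> stands for \<open>x \<prec>\<^sub>\<omega> y\<close>. Only their values at indices in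
  \<open>\<Omega>\<close> and at elements of the carrier matter.
\<close>

definition linear_maps ::
  "('r, 'k) ring_scheme \<Rightarrow> ('r, 'a, 'm) module_scheme \<Rightarrow> ('r, 'b, 'n) module_scheme \<Rightarrow> ('a \<Rightarrow> 'b) set"
  where "linear_maps R M N =
    {f \<in> hom (add_monoid M) (add_monoid N).
      \<forall>a \<in> carrier R. \<forall>x \<in> carrier M. f (a \<odot>\<^bsub>M\<^esub> x) = a \<odot>\<^bsub>N\<^esub> f x}"

definition bilinear_ops ::
  "('r, 'k) ring_scheme \<Rightarrow> ('r, 'a, 'm) module_scheme \<Rightarrow> ('a \<Rightarrow> 'a \<Rightarrow> 'a) set"
  where "bilinear_ops R M =
    {b. (\<forall>y \<in> carrier M. (\<lambda>x. b x y) \<in> linear_maps R M M) \<and>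
        (\<forall>x \<in> carrier M. (\<lambda>y. b x y) \<in> linear_maps R M M)}"

locale matching_Hom_dendriform_algebra = Module.module R D
  for R :: "('r, 'k) ring_scheme" (structure) and D :: "('r, 'd, 'm) module_scheme" (structure) +
  fixes \<Omega> :: "'w set" and prec succ :: "'w \<Rightarrow> 'd \<Rightarrow> 'd \<Rightarrow> 'd" and p :: "'d \<Rightarrow> 'd"
  assumes prec_bilinear: "\<omega> \<in> \<Omega> \<Longrightarrow> prec \<omega> \<in> bilinear_ops R D"
    and succ_bilinear: "\<omega> \<in> \<Omega> \<Longrightarrow> succ \<omega> \<in> bilinear_ops R D"
    and p_linear: "p \<in> linear_maps R D D"
    and prec_prec:
      "\<lbrakk>\<alpha> \<in> \<Omega>; \<beta> \<in> \<Omega>; x \<in> carrier D; y \<in> carrier D; z \<in> carrier D\<rbrakk> \<Longrightarrow>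
        prec \<beta> (prec \<alpha> x y) (p z) =
          prec \<alpha> (p x) (prec \<beta> y z) \<oplus>\<^bsub>D\<^esub> prec \<beta> (p x) (succ \<alpha> y z)"
    and succ_prec:
      "\<lbrakk>\<alpha> \<in> \<Omega>; \<beta> \<in> \<Omega>; x \<in> carrier D; y \<in> carrier D; z \<in> carrier D\<rbrakk> \<Longrightarrow>
        prec \<beta> (succ \<alpha> x y) (p z) = succ \<alpha> (p x) (prec \<beta> y z)"
    and succ_succ:
      "\<lbrakk>\<alpha> \<in> \<Omega>; \<beta> \<in> \<Omega>; x \<in> carrier D; y \<in> carrier D; z \<in> carrier D\<rbrakk> \<Longrightarrow>
        succ \<alpha> (prec \<beta> x y) (p z) \<oplus>\<^bsub>D\<^esub> succ \<beta> (succ \<alpha> x y) (p z) =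
          succ \<alpha> (p x) (succ \<beta> y z)"

locale matching_Hom_tridendriform_algebra = Module.module R D
  for R :: "('r, 'k) ring_scheme" (structure) and D :: "('r, 'd, 'm) module_scheme" (structure) +
  fixes \<Omega> :: "'w set" and prec dot succ :: "'w \<Rightarrow> 'd \<Rightarrow> 'd \<Rightarrow> 'd" and p :: "'d \<Rightarrow> 'd"
  assumes prec_bilinear: "\<omega> \<in> \<Omega> \<Longrightarrow> prec \<omega> \<in> bilinear_ops R D"
    and dot_bilinear: "\<omega> \<in> \<Omega> \<Longrightarrow> dot \<omega> \<in> bilinear_ops R D"
    and succ_bilinear: "\<omega> \<in> \<Omega> \<Longrightarrow> succ \<omega> \<in> bilinear_ops R D"
    and p_linear: "p \<in> linear_maps R D D"
    and prec_prec:
      "\<lbrakk>\<alpha> \<in> \<Omega>; \<beta> \<in> \<Omega>; x \<in> carrier D; y \<in> carrier D; z \<in> carrier D\<rbrakk> \<Longrightarrow>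
        prec \<beta> (prec \<alpha> x y) (p z) =
          prec \<alpha> (p x) (prec \<beta> y z) \<oplus>\<^bsub>D\<^esub> prec \<beta> (p x) (succ \<alpha> y z)
            \<oplus>\<^bsub>D\<^esub> prec \<alpha> (p x) (dot \<beta> y z)"
    and succ_prec:
      "\<lbrakk>\<alpha> \<in> \<Omega>; \<beta> \<in> \<Omega>; x \<in> carrier D; y \<in> carrier D; z \<in> carrier D\<rbrakk> \<Longrightarrow>
        prec \<beta> (succ \<alpha> x y) (p z) = succ \<alpha> (p x) (prec \<beta> y z)"
    and succ_succ:
      "\<lbrakk>\<alpha> \<in> \<Omega>; \<beta> \<in> \<Omega>; x \<in> carrier D; y \<in> carrier D; z \<in> carrier D\<rbrakk> \<Longrightarrow>
        succ \<alpha> (p x) (succ \<beta> y z) =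
          succ \<alpha> (prec \<beta> x y) (p z) \<oplus>\<^bsub>D\<^esub> succ \<beta> (succ \<alpha> x y) (p z)
            \<oplus>\<^bsub>D\<^esub> succ \<alpha> (dot \<beta> x y) (p z)"
    and succ_dot:
      "\<lbrakk>\<alpha> \<in> \<Omega>; \<beta> \<in> \<Omega>; x \<in> carrier D; y \<in> carrier D; z \<in> carrier D\<rbrakk> \<Longrightarrow>
        dot \<beta> (succ \<alpha> x y) (p z) = succ \<alpha> (p x) (dot \<beta> y z)"
    and prec_dot:
      "\<lbrakk>\<alpha> \<in> \<Omega>; \<beta> \<in> \<Omega>; x \<in> carrier D; y \<in> carrier D; z \<in> carrier D\<rbrakk> \<Longrightarrow>
        dot \<beta> (prec \<alpha> x y) (p z) = dot \<beta> (p x) (succ \<alpha> y z)"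
    and dot_prec:
      "\<lbrakk>\<alpha> \<in> \<Omega>; \<beta> \<in> \<Omega>; x \<in> carrier D; y \<in> carrier D; z \<in> carrier D\<rbrakk> \<Longrightarrow>
        prec \<beta> (dot \<alpha> x y) (p z) = dot \<alpha> (p x) (prec \<beta> y z)"
    and dot_dot:
      "\<lbrakk>\<alpha> \<in> \<Omega>; \<beta> \<in> \<Omega>; x \<in> carrier D; y \<in> carrier D; z \<in> carrier D\<rbrakk> \<Longrightarrow>
        dot \<beta> (dot \<alpha> x y) (p z) = dot \<alpha> (p x) (dot \<beta> y z)"

definition matching_dendriform_algebra ::
  "('r, 'k) ring_scheme \<Rightarrow> ('r, 'd, 'm) module_scheme \<Rightarrow> 'w set \<Rightarrow>
    ('w \<Rightarrow> 'd \<Rightarrow> 'd \<Rightarrow> 'd) \<Rightarrow> ('w \<Rightarrow> 'd \<Rightarrow> 'd \<Rightarrow> 'd) \<Rightarrow> bool"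
  where "matching_dendriform_algebra R D \<Omega> prec succ \<longleftrightarrow>
    matching_Hom_dendriform_algebra R D \<Omega> prec succ id"

definition matching_tridendriform_algebra ::
  "('r, 'k) ring_scheme \<Rightarrow> ('r, 'd, 'm) module_scheme \<Rightarrow> 'w set \<Rightarrow>
    ('w \<Rightarrow> 'd \<Rightarrow> 'd \<Rightarrow> 'd) \<Rightarrow> ('w \<Rightarrow> 'd \<Rightarrow> 'd \<Rightarrow> 'd) \<Rightarrow> ('w \<Rightarrow> 'd \<Rightarrow> 'd \<Rightarrow> 'd) \<Rightarrow> bool"
  where "matching_tridendriform_algebra R D \<Omega> prec dot succ \<longleftrightarrow>
    matching_Hom_tridendriform_algebra R D \<Omega> prec dot succ id"

definition preserves_ops ::
  "('d, 'm) partial_object_scheme \<Rightarrow> 'w set \<Rightarrow> ('w \<Rightarrow> 'd \<Rightarrow> 'd \<Rightarrow> 'd) \<Rightarrow> ('w \<Rightarrow> 'e \<Rightarrow> 'e \<Rightarrow> 'e) \<Rightarrow>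
    ('d \<Rightarrow> 'e) \<Rightarrow> bool"
  where "preserves_ops D \<Omega> op op' f \<longleftrightarrow>
    (\<forall>\<omega> \<in> \<Omega>. \<forall>x \<in> carrier D. \<forall>y \<in> carrier D. f (op \<omega> x y) = op' \<omega> (f x) (f y))"

text \<open>
  Being a morphism includes that source and target are algebras of the respective kind.
\<close>

definition matching_dendriform_morphism where
  "matching_dendriform_morphism R \<Omega> D prec succ D' prec' succ' f \<longleftrightarrow>
    matching_dendriform_algebra R D \<Omega> prec succ \<and>
    matching_dendriform_algebra R D' \<Omega> prec' succ' \<and>
    f \<in> linear_maps R D D' \<and>
    preserves_ops D \<Omega> prec prec' f \<and>
    preserves_ops D \<Omega> succ succ' f"

definition matching_tridendriform_morphism where
  "matching_tridendriform_morphism R \<Omega> D prec dot succ D' prec' dot' succ' f \<longleftrightarrow>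
    matching_tridendriform_algebra R D \<Omega> prec dot succ \<and>
    matching_tridendriform_algebra R D' \<Omega> prec' dot' succ' \<and>
    f \<in> linear_maps R D D' \<and>
    preserves_ops D \<Omega> prec prec' f \<and>
    preserves_ops D \<Omega> dot dot' f \<and>
    preserves_ops D \<Omega> succ succ' f"

definition matching_Hom_dendriform_morphism where
  "matching_Hom_dendriform_morphism R \<Omega> D prec succ p D' prec' succ' p' f \<longleftrightarrow>
    matching_Hom_dendriform_algebra R D \<Omega> prec succ p \<and>
    matching_Hom_dendriform_algebra R D' \<Omega> prec' succ' p' \<and>
    f \<in> linear_maps R D D' \<and>
    preserves_ops D \<Omega> prec prec' f \<and>
    preserves_ops D \<Omega> succ succ' f \<and>
    (\<forall>x \<in> carrier D. p' (f x) = f (p x))"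

definition matching_Hom_tridendriform_morphism where
  "matching_Hom_tridendriform_morphism R \<Omega> D prec dot succ p D' prec' dot' succ' p' f \<longleftrightarrow>
    matching_Hom_tridendriform_algebra R D \<Omega> prec dot succ p \<and>
    matching_Hom_tridendriform_algebra R D' \<Omega> prec' dot' succ' p' \<and>
    f \<in> linear_maps R D D' \<and>
    preserves_ops D \<Omega> prec prec' f \<and>
    preserves_ops D \<Omega> dot dot' f \<and>
    preserves_ops D \<Omega> succ succ' f \<and>
    (\<forall>x \<in> carrier D. p' (f x) = f (p x))"

abbreviation matching_dendriform_endomorphism where
  "matching_dendriform_endomorphism R \<Omega> D prec succ p \<equiv>
    matching_dendriform_morphism R \<Omega> D prec succ D prec succ p"

abbreviation matching_tridendriform_endomorphism where
  "matching_tridendriform_endomorphism R \<Omega> D prec dot succ p \<equiv>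
    matching_tridendriform_morphism R \<Omega> D prec dot succ D prec dot succ p"

definition twist :: "('d \<Rightarrow> 'd) \<Rightarrow> ('w \<Rightarrow> 'd \<Rightarrow> 'd \<Rightarrow> 'd) \<Rightarrow> 'w \<Rightarrow> 'd \<Rightarrow> 'd \<Rightarrow> 'd"
  where "twist p op = (\<lambda>\<omega> x y. p (op \<omega> x y))"

end

theory Submission
  imports Defs
begin

text \<open>
  This is the Yau twisting principle. Let \<open>p\<close> be an endomorphism for the operations \<open>\<circ>\<close> and \<open>\<star>\<close>,
  and write \<open>x \<circ>\<^sub>p y = p (x \<circ> y)\<close> for the twisted operation. Every monomial in a Hom-type axiom for the
  twisted operations has the form \<open>(x \<star>\<^sub>p y) \<circ>\<^sub>p p z\<close> or \<open>p x \<circ>\<^sub>p (y \<star>\<^sub>p z)\<close>: exactly one of the outer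
  arguments is a product, hence an image under \<open>p\<close>, and the Hom-type axiom puts a \<open>p\<close> on the other
  one. Multiplicativity of \<open>p\<close> then gives
  \<open>(x \<star>\<^sub>p y) \<circ>\<^sub>p p z = p (p ((x \<star> y) \<circ> z))\<close> and
  \<open>p x \<circ>\<^sub>p (y \<star>\<^sub>p z) = p (p (x \<circ> (y \<star> z)))\<close>,
  which are \<open>twist_left_nested\<close> and \<open>twist_right_nested\<close>. Since \<open>p\<^sup>2\<close> is additive,
  each twisted axiom is the image under \<open>p\<^sup>2\<close> of the corresponding untwisted one. This argument
  does not depend on the particular axioms, so the dendriform and the tridendriform case have the
  same proof.

  A morphism \<open>f\<close> with \<open>f p = p' f\<close> respects the twisted operations because
  \<open>f (p (x \<circ> y)) = p' (f (x \<circ> y)) = p' (f x \<circ>' f y)\<close>.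
\<close>

lemma linear_maps_closed:
  assumes "f \<in> linear_maps R M N" "x \<in> carrier M"
  shows "f x \<in> carrier N"
  using assms by (auto simp: linear_maps_def hom_def)

lemma linear_maps_add:
  assumes "f \<in> linear_maps R M N" "x \<in> carrier M" "y \<in> carrier M"
  shows "f (x \<oplus>\<^bsub>M\<^esub> y) = f x \<oplus>\<^bsub>N\<^esub> f y"
  using assms by (auto simp: linear_maps_def hom_def)

lemma linear_maps_compose:
  assumes "f \<in> linear_maps R L M" "g \<in> linear_maps R M N"
  shows "(\<lambda>x. g (f x)) \<in> linear_maps R L N"
  using assms by (auto simp: linear_maps_def hom_def Pi_iff)

lemma bilinear_ops_closed:
  assumes "b \<in> bilinear_ops R M" "x \<in> carrier M" "y \<in> carrier M"
  shows "b x y \<in> carrier M"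
proof -
  have "(\<lambda>x. b x y) \<in> linear_maps R M M"
    using assms by (simp add: bilinear_ops_def)
  then show ?thesis
    using assms(2) by (rule linear_maps_closed)
qed

lemma twist_bilinear:
  assumes "op \<omega> \<in> bilinear_ops R M" "p \<in> linear_maps R M M"
  shows "twist p op \<omega> \<in> bilinear_ops R M"
  using assms by (auto simp: bilinear_ops_def twist_def intro: linear_maps_compose)

text \<open>
  Both arguments of the outer product are images under \<open>p\<close>, so multiplicativity pulls one \<open>p\<close> out of
  it; the second \<open>p\<close> is the twist of the outer product itself.
\<close>

lemma twist_left_nested:
  assumes "preserves_ops D \<Omega> op op p" "\<beta> \<in> \<Omega>" "op' \<alpha> x y \<in> carrier D" "z \<in> carrier D"
  shows "twist p op \<beta> (twist p op' \<alpha> x y) (p z) = p (p (op \<beta> (op' \<alpha> x y) z))"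
  using assms by (simp add: twist_def preserves_ops_def)

lemma twist_right_nested:
  assumes "preserves_ops D \<Omega> op op p" "\<alpha> \<in> \<Omega>" "x \<in> carrier D" "op' \<beta> y z \<in> carrier D"
  shows "twist p op \<alpha> (p x) (twist p op' \<beta> y z) = p (p (op \<alpha> x (op' \<beta> y z)))"
  using assms by (simp add: twist_def preserves_ops_def)

lemma preserves_ops_twist:
  assumes op: "\<And>\<omega>. \<omega> \<in> \<Omega> \<Longrightarrow> op \<omega> \<in> bilinear_ops R D"
    and f: "preserves_ops D \<Omega> op op' f"
    and comm: "\<And>x. x \<in> carrier D \<Longrightarrow> f (p x) = p' (f x)"
  shows "preserves_ops D \<Omega> (twist p op) (twist p' op') f"
  using f by (simp add: preserves_ops_def twist_def comm bilinear_ops_closed[OF op])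

lemma twist_dendriform_algebra:
  assumes "matching_dendriform_algebra R D \<Omega> prec succ"
    and "matching_dendriform_endomorphism R \<Omega> D prec succ p"
  shows "matching_Hom_dendriform_algebra R D \<Omega> (twist p prec) (twist p succ) p"
proof -
  interpret D: matching_Hom_dendriform_algebra R D \<Omega> prec succ id
    using assms(1) by (simp add: matching_dendriform_algebra_def)
  have p: "p \<in> linear_maps R D D"
    and prec_p: "preserves_ops D \<Omega> prec prec p"
    and succ_p: "preserves_ops D \<Omega> succ succ p"
    using assms(2) by (simp_all add: matching_dendriform_morphism_def)
  note closed =
    bilinear_ops_closed[OF D.prec_bilinear]
    bilinear_ops_closed[OF D.succ_bilinear]
  note nested =
    twist_left_nested[OF prec_p] twist_right_nested[OF prec_p]
    twist_left_nested[OF succ_p] twist_right_nested[OF succ_p]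
  have sum: "p (p u) \<oplus>\<^bsub>D\<^esub> p (p v) = p (p (u \<oplus>\<^bsub>D\<^esub> v))"
    if "u \<in> carrier D" "v \<in> carrier D" for u v
    using that p by (simp add: linear_maps_add linear_maps_closed)
  show ?thesis
  proof (intro matching_Hom_dendriform_algebra.intro matching_Hom_dendriform_algebra_axioms.intro)
    show "Module.module R D"
      by (rule D.module_axioms)
    \<comment> \<open>\<open>nested\<close> and \<open>sum\<close> bring both sides of each axiom to the form \<open>p (p _)\<close>, where the untwisted
      axiom applies; \<open>[simplified]\<close> clears the \<open>id\<close> from the untwisted axioms.\<close>
  qed (simp_all add: p twist_bilinear nested closed sum
      D.prec_bilinear D.succ_bilinear
      D.prec_prec[simplified] D.succ_prec[simplified] D.succ_succ[simplified])
qed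

lemma twist_dendriform_morphism:
  assumes "matching_dendriform_endomorphism R \<Omega> D prec succ p"
    and "matching_dendriform_endomorphism R \<Omega> D' prec' succ' p'"
    and "matching_dendriform_morphism R \<Omega> D prec succ D' prec' succ' f"
    and "\<And>x. x \<in> carrier D \<Longrightarrow> f (p x) = p' (f x)"
  shows "matching_Hom_dendriform_morphism R \<Omega>
    D (twist p prec) (twist p succ) p D' (twist p' prec') (twist p' succ') p' f"
proof -
  have D: "matching_dendriform_algebra R D \<Omega> prec succ"
    and D': "matching_dendriform_algebra R D' \<Omega> prec' succ'"
    using assms(3) by (simp_all add: matching_dendriform_morphism_def)
  interpret D: matching_Hom_dendriform_algebra R D \<Omega> prec succ id
    using D by (simp add: matching_dendriform_algebra_def)
  show ?thesis
    unfolding matching_Hom_dendriform_morphism_def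
    using assms(3,4) twist_dendriform_algebra[OF D assms(1)] twist_dendriform_algebra[OF D' assms(2)]
    by (auto simp: matching_dendriform_morphism_def
      intro: preserves_ops_twist[OF D.prec_bilinear]
        preserves_ops_twist[OF D.succ_bilinear])
qed

lemma twist_tridendriform_algebra:
  assumes "matching_tridendriform_algebra R D \<Omega> prec dot succ"
    and "matching_tridendriform_endomorphism R \<Omega> D prec dot succ p"
  shows "matching_Hom_tridendriform_algebra R D \<Omega> (twist p prec) (twist p dot) (twist p succ) p"
proof -
  interpret D: matching_Hom_tridendriform_algebra R D \<Omega> prec dot succ id
    using assms(1) by (simp add: matching_tridendriform_algebra_def)
  have p: "p \<in> linear_maps R D D"
    and prec_p: "preserves_ops D \<Omega> prec prec p"
    and dot_p: "preserves_ops D \<Omega> dot dot p"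
    and succ_p: "preserves_ops D \<Omega> succ succ p"
    using assms(2) by (simp_all add: matching_tridendriform_morphism_def)
  note closed =
    bilinear_ops_closed[OF D.prec_bilinear]
    bilinear_ops_closed[OF D.dot_bilinear]
    bilinear_ops_closed[OF D.succ_bilinear]
  note nested =
    twist_left_nested[OF prec_p] twist_right_nested[OF prec_p]
    twist_left_nested[OF dot_p] twist_right_nested[OF dot_p]
    twist_left_nested[OF succ_p] twist_right_nested[OF succ_p]
  have sum: "p (p u) \<oplus>\<^bsub>D\<^esub> p (p v) = p (p (u \<oplus>\<^bsub>D\<^esub> v))"
    if "u \<in> carrier D" "v \<in> carrier D" for u v
    using that p by (simp add: linear_maps_add linear_maps_closed)
  show ?thesis
  proof (intro matching_Hom_tridendriform_algebra.intro matching_Hom_tridendriform_algebra_axioms.intro)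
    show "Module.module R D"
      by (rule D.module_axioms)
    \<comment> \<open>\<open>nested\<close> and \<open>sum\<close> bring both sides of each axiom to the form \<open>p (p _)\<close>, where the untwisted
      axiom applies; \<open>[simplified]\<close> clears the \<open>id\<close> from the untwisted axioms.\<close>
  qed (simp_all add: p twist_bilinear nested closed sum
      D.prec_bilinear D.dot_bilinear D.succ_bilinear
      D.prec_prec[simplified] D.succ_prec[simplified] D.succ_succ[simplified]
      D.succ_dot[simplified] D.prec_dot[simplified] D.dot_prec[simplified] D.dot_dot[simplified])
qed

lemma twist_tridendriform_morphism:
  assumes "matching_tridendriform_endomorphism R \<Omega> D prec dot succ p"
    and "matching_tridendriform_endomorphism R \<Omega> D' prec' dot' succ' p'"
    and "matching_tridendriform_morphism R \<Omega> D prec dot succ D' prec' dot' succ' f"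
    and "\<And>x. x \<in> carrier D \<Longrightarrow> f (p x) = p' (f x)"
  shows "matching_Hom_tridendriform_morphism R \<Omega>
    D (twist p prec) (twist p dot) (twist p succ) p
    D' (twist p' prec') (twist p' dot') (twist p' succ') p' f"
proof -
  have D: "matching_tridendriform_algebra R D \<Omega> prec dot succ"
    and D': "matching_tridendriform_algebra R D' \<Omega> prec' dot' succ'"
    using assms(3) by (simp_all add: matching_tridendriform_morphism_def)
  interpret D: matching_Hom_tridendriform_algebra R D \<Omega> prec dot succ id
    using D by (simp add: matching_tridendriform_algebra_def)
  show ?thesis
    unfolding matching_Hom_tridendriform_morphism_def
    using assms(3,4) twist_tridendriform_algebra[OF D assms(1)] twist_tridendriform_algebra[OF D' assms(2)]
    by (auto simp: matching_tridendriform_morphism_def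
      intro: preserves_ops_twist[OF D.prec_bilinear]
        preserves_ops_twist[OF D.dot_bilinear]
        preserves_ops_twist[OF D.succ_bilinear])
qed

theorem theorem4p4:
  fixes R :: "('r, 'k) ring_scheme" and \<Omega> :: "'w set"
  assumes "cring R" and "\<Omega> \<noteq> {}"
  shows
    "(\<forall>(D :: ('r, 'd, 'm) module_scheme) prec succ p.
        matching_dendriform_algebra R D \<Omega> prec succ \<and>
        matching_dendriform_endomorphism R \<Omega> D prec succ p \<longrightarrow>
          matching_Hom_dendriform_algebra R D \<Omega> (twist p prec) (twist p succ) p \<and>
          (\<forall>(D' :: ('r, 'e, 'n) module_scheme) prec' succ' p' f.
            matching_dendriform_algebra R D' \<Omega> prec' succ' \<and>
            matching_dendriform_endomorphism R \<Omega> D' prec' succ' p' \<and>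
            matching_dendriform_morphism R \<Omega> D prec succ D' prec' succ' f \<and>
            (\<forall>x \<in> carrier D. f (p x) = p' (f x)) \<longrightarrow>
              matching_Hom_dendriform_morphism R \<Omega>
                D (twist p prec) (twist p succ) p
                D' (twist p' prec') (twist p' succ') p' f))
     \<and>
     (\<forall>(D :: ('r, 'd, 'm) module_scheme) prec dot succ p.
        matching_tridendriform_algebra R D \<Omega> prec dot succ \<and>
        matching_tridendriform_endomorphism R \<Omega> D prec dot succ p \<longrightarrow>
          matching_Hom_tridendriform_algebra R D \<Omega> (twist p prec) (twist p dot) (twist p succ) p \<and>
          (\<forall>(D' :: ('r, 'e, 'n) module_scheme) prec' dot' succ' p' f.
            matching_tridendriform_algebra R D' \<Omega> prec' dot' succ' \<and>
            matching_tridendriform_endomorphism R \<Omega> D' prec' dot' succ' p' \<and>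
            matching_tridendriform_morphism R \<Omega> D prec dot succ D' prec' dot' succ' f \<and>
            (\<forall>x \<in> carrier D. f (p x) = p' (f x)) \<longrightarrow>
              matching_Hom_tridendriform_morphism R \<Omega>
                D (twist p prec) (twist p dot) (twist p succ) p
                D' (twist p' prec') (twist p' dot') (twist p' succ') p' f))"
  by (intro conjI allI impI twist_dendriform_algebra twist_dendriform_morphism
      twist_tridendriform_algebra twist_tridendriform_morphism; blast)

end
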